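(* Let $L_1,L_2,L_3$ be distinct non-null lines with spreads $S_1\equiv S(L_2,L_3)$, $S_2\equiv S(L_1,L_3)$, $S_3\equiv S(L_1,L_2)$. If the points $L_1L_3$ and $L_2L_3$ are perpendicular, then $$S_3=S_1+S_2-S_1S_2.$$
   Context: Let $\mathbb F$ be a field of characteristic not two. A 3-proportion $x:y:z$ is a triple of elements of $\mathbb F$, not all zero, up to a common non-zero scalar. A point $a=[x:y:z]$ and a line $L=(l:m:n)$ are both 3-proportions. The point $[x:y:z]$ lies on the line $(l:m:n)$ when $lx+my-nz=0$. For distinct lines $L,M$, the meet $LM$ is the unique point lying on both. A line $(l:m:n)$ is null when $l^2+m^2-n^2=0$. Points $[x_1:y_1:z_1]$ and $[x_2:y_2:z_2]$ are perpendicular when $x_1x_2+y_1y_2-z_1z_2=0$. The spread between non-null lines $L_1=(l_1:m_1:n_1)$ and $L_2=(l_2:m_2:n_2)$ is $$S(L_1,L_2)=1-\frac{(l_1l_2+m_1m_2-n_1n_2)^2}{(l_1^2+m_1^2-n_1^2)(l_2^2+m_2^2-n_2^2)};$$ it is undefined if either line is null. *)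

theory Defs
  imports Main
begin

fun proportional :: "'a::field \<times> 'a \<times> 'a \<Rightarrow> 'a \<times> 'a \<times> 'a \<Rightarrow> bool" where
  "proportional (x, y, z) (x', y', z') \<longleftrightarrow>
     (x, y, z) \<noteq> (0, 0, 0) \<and> (x', y', z') \<noteq> (0, 0, 0) \<and>
     (\<exists>c. c \<noteq> 0 \<and> x' = c * x \<and> y' = c * y \<and> z' = c * z)"

lemma part_equivp_proportional: "part_equivp (proportional :: 'a::field \<times> 'a \<times> 'a \<Rightarrow> _)"
proof (rule part_equivpI)
  have "proportional (1, 0, 0) (1, 0, 0 :: 'a)"
    by (auto intro: exI[of _ 1])
  then show "\<exists>t. proportional t (t :: 'a \<times> 'a \<times> 'a)" ..
  show "symp (proportional :: 'a \<times> 'a \<times> 'a \<Rightarrow> _)"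
  proof (rule sympI)
    fix s t :: "'a \<times> 'a \<times> 'a"
    assume st: "proportional s t"
    obtain x y z where s: "s = (x, y, z)" by (cases s)
    obtain x' y' z' where t: "t = (x', y', z')" by (cases t)
    from st s t obtain c where "c \<noteq> 0" "x' = c * x" "y' = c * y" "z' = c * z" by auto
    then have "x = inverse c * x'" "y = inverse c * y'" "z = inverse c * z'" "inverse c \<noteq> 0"
      by auto
    with st s t show "proportional t s"
      unfolding s t proportional.simps by blast
  qed
  show "transp (proportional :: 'a \<times> 'a \<times> 'a \<Rightarrow> _)"
  proof (rule transpI)
    fix s t u :: "'a \<times> 'a \<times> 'a"
    assume st: "proportional s t" and tu: "proportional t u"
    obtain x y z where s: "s = (x, y, z)" by (cases s)
    obtain x' y' z' where t: "t = (x', y', z')" by (cases t)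
    obtain x'' y'' z'' where u: "u = (x'', y'', z'')" by (cases u)
    from st s t obtain c where "c \<noteq> 0" "x' = c * x" "y' = c * y" "z' = c * z" by auto
    moreover from tu t u obtain d where "d \<noteq> 0" "x'' = d * x'" "y'' = d * y'" "z'' = d * z'"
      by auto
    ultimately have "d * c \<noteq> 0" "x'' = d * c * x" "y'' = d * c * y" "z'' = d * c * z"
      by auto
    with st tu show "proportional s u"
      unfolding s t u proportional.simps by blast
  qed
qed

quotient_type (overloaded) 'a proportion3 = "'a::field \<times> 'a \<times> 'a" / partial: proportional
  by (rule part_equivp_proportional)

type_synonym 'a point = "'a proportion3"
type_synonym 'a line = "'a proportion3"

lift_definition lies_on :: "'a::field point \<Rightarrow> 'a line \<Rightarrow> bool"
  is "\<lambda>(x, y, z) (l, m, n). l * x + m * y - n * z = 0"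
proof -
  fix s s' t t' :: "'a \<times> 'a \<times> 'a"
  assume *: "proportional s s'" "proportional t t'"
  obtain x y z where s: "s = (x, y, z)" by (cases s)
  obtain x' y' z' where s': "s' = (x', y', z')" by (cases s')
  obtain l m n where t: "t = (l, m, n)" by (cases t)
  obtain l' m' n' where t': "t' = (l', m', n')" by (cases t')
  from * s s' obtain c where c: "c \<noteq> 0" "x' = c * x" "y' = c * y" "z' = c * z" by auto
  from * t t' obtain d where d: "d \<noteq> 0" "l' = d * l" "m' = d * m" "n' = d * n" by auto
  have "l' * x' + m' * y' - n' * z' = (d * c) * (l * x + m * y - n * z)"
    using c d by (simp add: algebra_simps)
  then show "(case s of (x, y, z) \<Rightarrow> \<lambda>(l, m, n). l * x + m * y - n * z = 0) t \<longleftrightarrow>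
    (case s' of (x, y, z) \<Rightarrow> \<lambda>(l, m, n). l * x + m * y - n * z = 0) t'"
    using c(1) d(1) unfolding s s' t t' prod.case by (simp only: mult_eq_0_iff simp_thms)
qed

lift_definition perpendicular :: "'a::field point \<Rightarrow> 'a point \<Rightarrow> bool"
  is "\<lambda>(x\<^sub>1, y\<^sub>1, z\<^sub>1) (x\<^sub>2, y\<^sub>2, z\<^sub>2). x\<^sub>1 * x\<^sub>2 + y\<^sub>1 * y\<^sub>2 - z\<^sub>1 * z\<^sub>2 = 0"
proof -
  fix s s' t t' :: "'a \<times> 'a \<times> 'a"
  assume *: "proportional s s'" "proportional t t'"
  obtain x y z where s: "s = (x, y, z)" by (cases s)
  obtain x' y' z' where s': "s' = (x', y', z')" by (cases s')
  obtain l m n where t: "t = (l, m, n)" by (cases t)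
  obtain l' m' n' where t': "t' = (l', m', n')" by (cases t')
  from * s s' obtain c where c: "c \<noteq> 0" "x' = c * x" "y' = c * y" "z' = c * z" by auto
  from * t t' obtain d where d: "d \<noteq> 0" "l' = d * l" "m' = d * m" "n' = d * n" by auto
  have "x' * l' + y' * m' - z' * n' = (d * c) * (x * l + y * m - z * n)"
    using c d by (simp add: algebra_simps)
  then show "(case s of (x\<^sub>1, y\<^sub>1, z\<^sub>1) \<Rightarrow> \<lambda>(x\<^sub>2, y\<^sub>2, z\<^sub>2). x\<^sub>1 * x\<^sub>2 + y\<^sub>1 * y\<^sub>2 - z\<^sub>1 * z\<^sub>2 = 0) t \<longleftrightarrow>
    (case s' of (x\<^sub>1, y\<^sub>1, z\<^sub>1) \<Rightarrow> \<lambda>(x\<^sub>2, y\<^sub>2, z\<^sub>2). x\<^sub>1 * x\<^sub>2 + y\<^sub>1 * y\<^sub>2 - z\<^sub>1 * z\<^sub>2 = 0) t'"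
    using c(1) d(1) unfolding s s' t t' prod.case by (simp only: mult_eq_0_iff simp_thms)
qed

lift_definition null_line :: "'a::field line \<Rightarrow> bool"
  is "\<lambda>(l, m, n). l\<^sup>2 + m\<^sup>2 - n\<^sup>2 = 0"
proof -
  fix t t' :: "'a \<times> 'a \<times> 'a"
  assume *: "proportional t t'"
  obtain l m n where t: "t = (l, m, n)" by (cases t)
  obtain l' m' n' where t': "t' = (l', m', n')" by (cases t')
  from * t t' obtain d where d: "d \<noteq> 0" "l' = d * l" "m' = d * m" "n' = d * n" by auto
  have "l'\<^sup>2 + m'\<^sup>2 - n'\<^sup>2 = d\<^sup>2 * (l\<^sup>2 + m\<^sup>2 - n\<^sup>2)"
    using d by (simp add: algebra_simps power2_eq_square)
  then show "(case t of (l, m, n) \<Rightarrow> l\<^sup>2 + m\<^sup>2 - n\<^sup>2 = 0) \<longleftrightarrow>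
    (case t' of (l, m, n) \<Rightarrow> l\<^sup>2 + m\<^sup>2 - n\<^sup>2 = 0)"
    using d(1) unfolding t t' prod.case by (simp only: mult_eq_0_iff power_eq_0_iff simp_thms)
qed

(* Meaningful only for distinct lines; see ex1_meet. *)
definition meet :: "'a::field line \<Rightarrow> 'a line \<Rightarrow> 'a point" where
  "meet L M = (THE a. lies_on a L \<and> lies_on a M)"

lemma ex1_meet:
  fixes L M :: "'a::field line"
  assumes "L \<noteq> M"
  shows "\<exists>!a. lies_on a L \<and> lies_on a M"
proof -
  obtain l m n where L: "L = abs_proportion3 (l, m, n)" and PL: "proportional (l, m, n) (l, m, n)"
    by (metis Quotient3_def Quotient3_proportion3 prod_cases3)
  obtain p q r where M: "M = abs_proportion3 (p, q, r)" and PM: "proportional (p, q, r) (p, q, r)"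
    by (metis Quotient3_def Quotient3_proportion3 prod_cases3)
  have np: "\<not> proportional (l, m, n) (p, q, r)"
    using assms L M PL PM Quotient3_rel[OF Quotient3_proportion3] by blast
  have on: "lies_on (abs_proportion3 (x, y, z)) (abs_proportion3 (a, b, c)) \<longleftrightarrow>
      a * x + b * y - c * z = 0"
    if "proportional (x, y, z) (x, y, z)" "proportional (a, b, c) (a, b, c)" for x y z a b c :: 'a
    using lies_on.abs_eq[OF that] by simp
  define X Y Z where "X = n * q - m * r" and "Y = l * r - n * p" and "Z = l * q - m * p"
  have nz: "(X, Y, Z) \<noteq> (0, 0, 0)"
  proof
    assume "(X, Y, Z) = (0, 0, 0)"
    then have e: "n * q = m * r" "l * r = n * p" "l * q = m * p"
      by (auto simp: X_def Y_def Z_def)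
    consider "l \<noteq> 0" | "m \<noteq> 0" | "n \<noteq> 0" using PL by auto
    then have "\<exists>c. p = c * l \<and> q = c * m \<and> r = c * n"
    proof cases
      case 1 then show ?thesis using e by (intro exI[of _ "p / l"]) (auto simp: field_simps)
    next
      case 2 then show ?thesis using e by (intro exI[of _ "q / m"]) (auto simp: field_simps)
    next
      case 3 then show ?thesis using e by (intro exI[of _ "r / n"]) (auto simp: field_simps)
    qed
    then obtain c where c: "p = c * l" "q = c * m" "r = c * n" by auto
    with PM have "c \<noteq> 0" by auto
    with c PL PM np show False by auto
  qed
  then have PX: "proportional (X, Y, Z) (X, Y, Z)"
    by (auto intro: exI[of _ 1])
  show ?thesis
  proof (rule ex1I[of _ "abs_proportion3 (X, Y, Z)"])
    show "lies_on (abs_proportion3 (X, Y, Z)) L \<and> lies_on (abs_proportion3 (X, Y, Z)) M"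
      unfolding L M on[OF PX PL] on[OF PX PM] by (simp add: X_def Y_def Z_def algebra_simps)
  next
    fix a assume a: "lies_on a L \<and> lies_on a M"
    obtain x y z where A: "a = abs_proportion3 (x, y, z)"
      and PA: "proportional (x, y, z) (x, y, z)"
      by (metis Quotient3_def Quotient3_proportion3 prod_cases3)
    from a have e: "l * x + m * y - n * z = 0" "p * x + q * y - r * z = 0"
      unfolding A L M on[OF PA PL] on[OF PA PM] by auto
    have c1: "X * y = Y * x" "Y * z = Z * y" "X * z = Z * x"
      using e unfolding X_def Y_def Z_def by algebra+
    consider "X \<noteq> 0" | "Y \<noteq> 0" | "Z \<noteq> 0" using nz by auto
    then have "\<exists>c. x = c * X \<and> y = c * Y \<and> z = c * Z"
    proof cases
      case 1 then show ?thesis using c1 by (intro exI[of _ "x / X"]) (auto simp: field_simps)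
    next
      case 2 then show ?thesis using c1 by (intro exI[of _ "y / Y"]) (auto simp: field_simps)
    next
      case 3 then show ?thesis using c1 by (intro exI[of _ "z / Z"]) (auto simp: field_simps)
    qed
    then obtain c where c: "x = c * X" "y = c * Y" "z = c * Z" by auto
    with PA have "c \<noteq> 0" by auto
    with c nz PA have "proportional (X, Y, Z) (x, y, z)" by auto
    then show "a = abs_proportion3 (X, Y, Z)"
      unfolding A using Quotient3_rel_abs[OF Quotient3_proportion3] by metis
  qed
qed

(* Undefined when either line is null; there, division by zero gives the irrelevant value 1. *)
lift_definition spread :: "'a::field line \<Rightarrow> 'a line \<Rightarrow> 'a"
  is "\<lambda>(l\<^sub>1, m\<^sub>1, n\<^sub>1) (l\<^sub>2, m\<^sub>2, n\<^sub>2).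
    1 - (l\<^sub>1 * l\<^sub>2 + m\<^sub>1 * m\<^sub>2 - n\<^sub>1 * n\<^sub>2)\<^sup>2 /
        ((l\<^sub>1\<^sup>2 + m\<^sub>1\<^sup>2 - n\<^sub>1\<^sup>2) * (l\<^sub>2\<^sup>2 + m\<^sub>2\<^sup>2 - n\<^sub>2\<^sup>2))"
proof -
  fix s s' t t' :: "'a \<times> 'a \<times> 'a"
  assume *: "proportional s s'" "proportional t t'"
  obtain x y z where s: "s = (x, y, z)" by (cases s)
  obtain x' y' z' where s': "s' = (x', y', z')" by (cases s')
  obtain l m n where t: "t = (l, m, n)" by (cases t)
  obtain l' m' n' where t': "t' = (l', m', n')" by (cases t')
  from * s s' obtain c where c: "c \<noteq> 0" "x' = c * x" "y' = c * y" "z' = c * z" by auto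
  from * t t' obtain d where d: "d \<noteq> 0" "l' = d * l" "m' = d * m" "n' = d * n" by auto
  have "(x' * l' + y' * m' - z' * n')\<^sup>2 = (c\<^sup>2 * d\<^sup>2) * (x * l + y * m - z * n)\<^sup>2"
    using c d by (simp add: algebra_simps power2_eq_square)
  moreover have "(x'\<^sup>2 + y'\<^sup>2 - z'\<^sup>2) * (l'\<^sup>2 + m'\<^sup>2 - n'\<^sup>2) =
      (c\<^sup>2 * d\<^sup>2) * ((x\<^sup>2 + y\<^sup>2 - z\<^sup>2) * (l\<^sup>2 + m\<^sup>2 - n\<^sup>2))"
    using c d by (simp add: algebra_simps power2_eq_square)
  moreover have "c\<^sup>2 * d\<^sup>2 \<noteq> 0" using c d by simp
  ultimately have "(x' * l' + y' * m' - z' * n')\<^sup>2 / ((x'\<^sup>2 + y'\<^sup>2 - z'\<^sup>2) * (l'\<^sup>2 + m'\<^sup>2 - n'\<^sup>2)) =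
      (x * l + y * m - z * n)\<^sup>2 / ((x\<^sup>2 + y\<^sup>2 - z\<^sup>2) * (l\<^sup>2 + m\<^sup>2 - n\<^sup>2))"
    by (simp only: nonzero_mult_divide_mult_cancel_left not_False_eq_True)
  then show "(case s of (l\<^sub>1, m\<^sub>1, n\<^sub>1) \<Rightarrow> \<lambda>(l\<^sub>2, m\<^sub>2, n\<^sub>2).
      1 - (l\<^sub>1 * l\<^sub>2 + m\<^sub>1 * m\<^sub>2 - n\<^sub>1 * n\<^sub>2)\<^sup>2 /
        ((l\<^sub>1\<^sup>2 + m\<^sub>1\<^sup>2 - n\<^sub>1\<^sup>2) * (l\<^sub>2\<^sup>2 + m\<^sub>2\<^sup>2 - n\<^sub>2\<^sup>2))) t =
    (case s' of (l\<^sub>1, m\<^sub>1, n\<^sub>1) \<Rightarrow> \<lambda>(l\<^sub>2, m\<^sub>2, n\<^sub>2).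
      1 - (l\<^sub>1 * l\<^sub>2 + m\<^sub>1 * m\<^sub>2 - n\<^sub>1 * n\<^sub>2)\<^sup>2 /
        ((l\<^sub>1\<^sup>2 + m\<^sub>1\<^sup>2 - n\<^sub>1\<^sup>2) * (l\<^sub>2\<^sup>2 + m\<^sub>2\<^sup>2 - n\<^sub>2\<^sup>2))) t'"
    unfolding s s' t t' prod.case by simp
qed

end

theory Submission
  imports Defs
begin

text \<open>
  Let \<open>B\<close> be the bilinear form \<open>l l' + m m' - n n'\<close>. The meet of two lines is represented by the
  (twisted) cross product of their coordinate vectors, and Lagrange's identity expresses the
  form on two such products: perpendicularity of \<open>L\<^sub>1L\<^sub>3\<close> and \<open>L\<^sub>2L\<^sub>3\<close> becomes
  \<open>B(L\<^sub>1,L\<^sub>2) B(L\<^sub>3,L\<^sub>3) = B(L\<^sub>1,L\<^sub>3) B(L\<^sub>2,L\<^sub>3)\<close>. Squaring and dividing by the norms gives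
  \<open>1 - S\<^sub>3 = (1 - S\<^sub>1)(1 - S\<^sub>2)\<close>.
\<close>

text \<open>\<open>proportional\<close> is only a partial equivalence:
  \<open>proportional t t\<close> holds exactly when \<open>t\<close> is not the zero triple. The
  second fact thus records that the representative is nonzero, and it is the premise that the
  \<open>abs_eq\<close> rules ask for.\<close>

lemma proportion3_cases:
  obtains x y z where "a = abs_proportion3 (x, y, z)" "proportional (x, y, z) (x, y, z)"
  by (metis Quotient3_def Quotient3_proportion3 prod_cases3)

lemma lies_on_meet:
  assumes "L \<noteq> M"
  shows "lies_on (meet L M) L" "lies_on (meet L M) M"
  using theI'[OF ex1_meet[OF assms]] unfolding meet_def by simp_all

text \<open>The three left-hand sides form the ordinary cross product of \<open>(l, m, -n)\<close>
  and \<open>(p, q, -r)\<close>, and \<open>(x, y, z)\<close> is orthogonal to both vectors. The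
  factor \<open>k\<close> is zero when the two lines are proportional.\<close>

lemma cross_product_multiple_of_common_point:
  fixes l m n p q r x y z :: "'a::field"
  assumes "l * x + m * y - n * z = 0" "p * x + q * y - r * z = 0" "(x, y, z) \<noteq> (0, 0, 0)"
  obtains k where "n * q - m * r = k * x" "l * r - n * p = k * y" "l * q - m * p = k * z"
proof -
  define X Y Z where "X = n * q - m * r" and "Y = l * r - n * p" and "Z = l * q - m * p"
  \<comment> \<open>The minors of the two triples vanish, so the triples are parallel; dividing by a
    nonzero coordinate of the point yields \<open>k\<close>.\<close>
  have e: "X * y = Y * x" "Y * z = Z * y" "X * z = Z * x"
    using assms(1,2) unfolding X_def Y_def Z_def by algebra+
  consider "x \<noteq> 0" | "y \<noteq> 0" | "z \<noteq> 0" using assms(3) by auto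
  then have "\<exists>k. X = k * x \<and> Y = k * y \<and> Z = k * z"
  proof cases
    case 1 then show ?thesis using e by (intro exI[of _ "X / x"]) (auto simp: field_simps)
  next
    case 2 then show ?thesis using e by (intro exI[of _ "Y / y"]) (auto simp: field_simps)
  next
    case 3 then show ?thesis using e by (intro exI[of _ "Z / z"]) (auto simp: field_simps)
  qed
  then show thesis using that unfolding X_def Y_def Z_def by blast
qed

lemma perpendicular_common_points:
  fixes l\<^sub>1 m\<^sub>1 n\<^sub>1 l\<^sub>2 m\<^sub>2 n\<^sub>2 l\<^sub>3 m\<^sub>3 n\<^sub>3 :: "'a::field"
  assumes "l\<^sub>1 * x + m\<^sub>1 * y - n\<^sub>1 * z = 0" "l\<^sub>3 * x + m\<^sub>3 * y - n\<^sub>3 * z = 0"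
    and "l\<^sub>2 * x' + m\<^sub>2 * y' - n\<^sub>2 * z' = 0" "l\<^sub>3 * x' + m\<^sub>3 * y' - n\<^sub>3 * z' = 0"
    and "(x, y, z) \<noteq> (0, 0, 0)" "(x', y', z') \<noteq> (0, 0, 0)"
    and "x * x' + y * y' - z * z' = 0"
  shows "(l\<^sub>1 * l\<^sub>2 + m\<^sub>1 * m\<^sub>2 - n\<^sub>1 * n\<^sub>2) * (l\<^sub>3\<^sup>2 + m\<^sub>3\<^sup>2 - n\<^sub>3\<^sup>2) =
    (l\<^sub>1 * l\<^sub>3 + m\<^sub>1 * m\<^sub>3 - n\<^sub>1 * n\<^sub>3) * (l\<^sub>2 * l\<^sub>3 + m\<^sub>2 * m\<^sub>3 - n\<^sub>2 * n\<^sub>3)"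
proof -
  obtain k where k: "n\<^sub>1 * m\<^sub>3 - m\<^sub>1 * n\<^sub>3 = k * x" "l\<^sub>1 * n\<^sub>3 - n\<^sub>1 * l\<^sub>3 = k * y"
      "l\<^sub>1 * m\<^sub>3 - m\<^sub>1 * l\<^sub>3 = k * z"
    using cross_product_multiple_of_common_point[OF assms(1,2,5)] .
  obtain k' where k': "n\<^sub>2 * m\<^sub>3 - m\<^sub>2 * n\<^sub>3 = k' * x'" "l\<^sub>2 * n\<^sub>3 - n\<^sub>2 * l\<^sub>3 = k' * y'"
      "l\<^sub>2 * m\<^sub>3 - m\<^sub>2 * l\<^sub>3 = k' * z'"
    using cross_product_multiple_of_common_point[OF assms(3,4,6)] .
  \<comment> \<open>Lagrange's identity, with the sign opposite to the Euclidean one because the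
    form has determinant -1. By bilinearity its right-hand side is \<open>k * k'\<close> times the
    perpendicularity expression.\<close>
  have "(l\<^sub>1 * l\<^sub>3 + m\<^sub>1 * m\<^sub>3 - n\<^sub>1 * n\<^sub>3) * (l\<^sub>2 * l\<^sub>3 + m\<^sub>2 * m\<^sub>3 - n\<^sub>2 * n\<^sub>3) -
      (l\<^sub>1 * l\<^sub>2 + m\<^sub>1 * m\<^sub>2 - n\<^sub>1 * n\<^sub>2) * (l\<^sub>3\<^sup>2 + m\<^sub>3\<^sup>2 - n\<^sub>3\<^sup>2) =
      (n\<^sub>1 * m\<^sub>3 - m\<^sub>1 * n\<^sub>3) * (n\<^sub>2 * m\<^sub>3 - m\<^sub>2 * n\<^sub>3) +
      (l\<^sub>1 * n\<^sub>3 - n\<^sub>1 * l\<^sub>3) * (l\<^sub>2 * n\<^sub>3 - n\<^sub>2 * l\<^sub>3) -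
      (l\<^sub>1 * m\<^sub>3 - m\<^sub>1 * l\<^sub>3) * (l\<^sub>2 * m\<^sub>3 - m\<^sub>2 * l\<^sub>3)"
    by algebra
  also have "\<dots> = k * k' * (x * x' + y * y' - z * z')"
    unfolding k k' by (simp add: algebra_simps)
  finally show ?thesis using assms(7) by simp
qed

theorem theorem43:
  fixes L\<^sub>1 L\<^sub>2 L\<^sub>3 :: "'a::field line" and S\<^sub>1 S\<^sub>2 S\<^sub>3 :: 'a
  assumes "CHAR('a) \<noteq> 2"
    and "L\<^sub>1 \<noteq> L\<^sub>2" and "L\<^sub>1 \<noteq> L\<^sub>3" and "L\<^sub>2 \<noteq> L\<^sub>3"
    and "\<not> null_line L\<^sub>1" and "\<not> null_line L\<^sub>2" and "\<not> null_line L\<^sub>3"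
    and "S\<^sub>1 = spread L\<^sub>2 L\<^sub>3" and "S\<^sub>2 = spread L\<^sub>1 L\<^sub>3" and "S\<^sub>3 = spread L\<^sub>1 L\<^sub>2"
    and "perpendicular (meet L\<^sub>1 L\<^sub>3) (meet L\<^sub>2 L\<^sub>3)"
  shows "S\<^sub>3 = S\<^sub>1 + S\<^sub>2 - S\<^sub>1 * S\<^sub>2"
proof -
  obtain l\<^sub>1 m\<^sub>1 n\<^sub>1 where L1: "L\<^sub>1 = abs_proportion3 (l\<^sub>1, m\<^sub>1, n\<^sub>1)"
    and P1: "proportional (l\<^sub>1, m\<^sub>1, n\<^sub>1) (l\<^sub>1, m\<^sub>1, n\<^sub>1)" by (rule proportion3_cases)
  obtain l\<^sub>2 m\<^sub>2 n\<^sub>2 where L2: "L\<^sub>2 = abs_proportion3 (l\<^sub>2, m\<^sub>2, n\<^sub>2)"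
    and P2: "proportional (l\<^sub>2, m\<^sub>2, n\<^sub>2) (l\<^sub>2, m\<^sub>2, n\<^sub>2)" by (rule proportion3_cases)
  obtain l\<^sub>3 m\<^sub>3 n\<^sub>3 where L3: "L\<^sub>3 = abs_proportion3 (l\<^sub>3, m\<^sub>3, n\<^sub>3)"
    and P3: "proportional (l\<^sub>3, m\<^sub>3, n\<^sub>3) (l\<^sub>3, m\<^sub>3, n\<^sub>3)" by (rule proportion3_cases)
  obtain x y z where A: "meet L\<^sub>1 L\<^sub>3 = abs_proportion3 (x, y, z)"
    and PA: "proportional (x, y, z) (x, y, z)" by (rule proportion3_cases)
  obtain x' y' z' where B: "meet L\<^sub>2 L\<^sub>3 = abs_proportion3 (x', y', z')"
    and PB: "proportional (x', y', z') (x', y', z')" by (rule proportion3_cases)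
  \<comment> \<open>With the norms and pairings kept as atoms, the final computation is a rational
    identity in these six quantities.\<close>
  define q\<^sub>1 q\<^sub>2 q\<^sub>3 where "q\<^sub>1 = l\<^sub>1\<^sup>2 + m\<^sub>1\<^sup>2 - n\<^sub>1\<^sup>2" and "q\<^sub>2 = l\<^sub>2\<^sup>2 + m\<^sub>2\<^sup>2 - n\<^sub>2\<^sup>2"
    and "q\<^sub>3 = l\<^sub>3\<^sup>2 + m\<^sub>3\<^sup>2 - n\<^sub>3\<^sup>2"
  note q_defs = q\<^sub>1_def q\<^sub>2_def q\<^sub>3_def
  define b\<^sub>1\<^sub>2 b\<^sub>1\<^sub>3 b\<^sub>2\<^sub>3 where "b\<^sub>1\<^sub>2 = l\<^sub>1 * l\<^sub>2 + m\<^sub>1 * m\<^sub>2 - n\<^sub>1 * n\<^sub>2"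
    and "b\<^sub>1\<^sub>3 = l\<^sub>1 * l\<^sub>3 + m\<^sub>1 * m\<^sub>3 - n\<^sub>1 * n\<^sub>3" and "b\<^sub>2\<^sub>3 = l\<^sub>2 * l\<^sub>3 + m\<^sub>2 * m\<^sub>3 - n\<^sub>2 * n\<^sub>3"
  note b_defs = b\<^sub>1\<^sub>2_def b\<^sub>1\<^sub>3_def b\<^sub>2\<^sub>3_def
  have q: "q\<^sub>1 \<noteq> 0" "q\<^sub>2 \<noteq> 0" "q\<^sub>3 \<noteq> 0"
    using assms(5-7) null_line.abs_eq[OF P1] null_line.abs_eq[OF P2] null_line.abs_eq[OF P3]
    unfolding L1 L2 L3 q_defs by simp_all
  have S: "S\<^sub>1 = 1 - b\<^sub>2\<^sub>3\<^sup>2 / (q\<^sub>2 * q\<^sub>3)" "S\<^sub>2 = 1 - b\<^sub>1\<^sub>3\<^sup>2 / (q\<^sub>1 * q\<^sub>3)" "S\<^sub>3 = 1 - b\<^sub>1\<^sub>2\<^sup>2 / (q\<^sub>1 * q\<^sub>2)"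
    using assms(8-10) spread.abs_eq[OF P2 P3] spread.abs_eq[OF P1 P3] spread.abs_eq[OF P1 P2]
    unfolding L1 L2 L3 q_defs b_defs by simp_all
  \<comment> \<open>Distinctness of the lines makes the description in \<open>meet\<close> well
    defined. \<open>A\<close> is unfolded first, while the arguments of \<open>meet\<close> are
    still \<open>L\<^sub>1\<close> and \<open>L\<^sub>3\<close>.\<close>
  have "l\<^sub>1 * x + m\<^sub>1 * y - n\<^sub>1 * z = 0" "l\<^sub>3 * x + m\<^sub>3 * y - n\<^sub>3 * z = 0"
    using lies_on_meet[OF assms(3)] lies_on.abs_eq[OF PA P1] lies_on.abs_eq[OF PA P3]
    unfolding A unfolding L1 L3 by simp_all
  moreover have "l\<^sub>2 * x' + m\<^sub>2 * y' - n\<^sub>2 * z' = 0" "l\<^sub>3 * x' + m\<^sub>3 * y' - n\<^sub>3 * z' = 0"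
    using lies_on_meet[OF assms(4)] lies_on.abs_eq[OF PB P2] lies_on.abs_eq[OF PB P3]
    unfolding B unfolding L2 L3 by simp_all
  moreover have "x * x' + y * y' - z * z' = 0"
    using assms(11) perpendicular.abs_eq[OF PA PB] unfolding A B by simp
  moreover have "(x, y, z) \<noteq> (0, 0, 0)" "(x', y', z') \<noteq> (0, 0, 0)"
    using PA PB by simp_all
  ultimately have "b\<^sub>1\<^sub>2 * q\<^sub>3 = b\<^sub>1\<^sub>3 * b\<^sub>2\<^sub>3"
    unfolding q_defs b_defs by (intro perpendicular_common_points)
  \<comment> \<open>Solving for \<open>b\<^sub>1\<^sub>2\<close> supplies, after squaring, the
    factor \<open>q\<^sub>3\<^sup>2\<close> in the denominator that the product of
    \<open>1 - S\<^sub>1\<close> and \<open>1 - S\<^sub>2\<close> has.\<close>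
  then have "b\<^sub>1\<^sub>2 = b\<^sub>1\<^sub>3 * b\<^sub>2\<^sub>3 / q\<^sub>3"
    using q(3) by (simp add: field_simps)
  then have "1 - S\<^sub>3 = (1 - S\<^sub>1) * (1 - S\<^sub>2)"
    unfolding S using q by (simp add: field_simps power2_eq_square)
  then show ?thesis by (simp add: algebra_simps)
qed

end
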